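(* (i) The quadruple $(h,I_1,I_2,I_3)$ is a hyper Kähler structure on a Lie algebra $\mathfrak g$ if and only if $(\omega_1,\omega_2,\omega_3)$ is an $\varepsilon$-hyper symplectic structure with $\varepsilon=(-1,-1,-1)$, where $\omega_i$, for $i=1,2,3$, are given by $\omega_i(x,y)=h(I_i(x),y)$ for all $x,y\in\mathfrak g$. (ii) The quadruple $(h,I_1,I_2,I_3)$ is a para-hyper Kähler structure on the Lie algebra $\mathfrak g$ if and only if $(\omega_1,\omega_2,\omega_3)$ is an $\varepsilon$-hyper symplectic structure with $\varepsilon=(1,1,-1)$, where $\omega_i$, for $i=1,2,3$, are given by $\omega_i(x,y)=h(I_i(x),y)$ for all $x,y\in\mathfrak g$.
   Context: In a quadruple $(h,I_1,I_2,I_3)$, $h$ is a bilinear form on $\mathfrak g$ and $I_1,I_2,I_3:\mathfrak g\to\mathfrak g$ are linear maps. A symplectic structure on a Lie algebra $\mathfrak g$ is a nondegenerate $2$-form $\omega\in\wedge^2\mathfrak g^*$ with $\omega([x,y],z)+\omega([z,x],y)+\omega([y,z],x)=0$ for all $x,y,z\in\mathfrak g$. For such $\omega$ define $\omega^\natural:\mathfrak g\to\mathfrak g^*$ by $\langle\omega^\natural(x),y\rangle=\omega(x,y)$. For a representation $(V;\rho)$ of $\mathfrak g$, a relative differential operator is a linear map $d:\mathfrak g\to V$ with $d[x,y]=\rho(x)d(y)-\rho(y)d(x)$ for all $x,y\in\mathfrak g$. Invertible relative differential operators $d_1,d_2,d_3$ with respect to $(V;\rho)$ form an $\varepsilon=(\varepsilon_1,\varepsilon_2,\varepsilon_3)$-hyper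 relative differential operator, $\varepsilon_i=\pm1$, if $(d_{i-1}^{-1}\circ d_{i+1})^2=\varepsilon_i\,\mathrm{Id}_{\mathfrak g}$ for $i=1,2,3$ (indices mod 3). An $\varepsilon$-hyper symplectic structure is a triple $(\omega_1,\omega_2,\omega_3)$ of symplectic structures on $\mathfrak g$ such that $(\omega_1^\natural,\omega_2^\natural,\omega_3^\natural)$ is an $\varepsilon$-hyper relative differential operator with respect to the coadjoint representation $(\mathfrak g^*;\mathrm{ad}^* )$, where $\langle\mathrm{ad}^*_x\xi,y\rangle=-\langle\xi,[x,y]\rangle$. A Nijenhuis operator on $\mathfrak g$ is a linear map $N:\mathfrak g\to\mathfrak g$ with $[Nx,Ny]=N([Nx,y]+[x,Ny]-N[x,y])$ for all $x,y$; it is a complex structure if $N^2=-\mathrm{Id}_{\mathfrak g}$ and a para-complex structure if $N^2=\mathrm{Id}_{\mathfrak g}$. A pseudo-metric is a nondegenerate symmetric bilinear form. A Hermitian structure on $\mathfrak g$ is a pair $(h,I)$ with $h$ a pseudo-metric and $I$ a complex structure such that $h(I(x),I(y))=h(x,y)$ for all $x,y$; a para-Hermitian structure is a pair $(h,I)$ with $h$ a pseudo-metric and $I$ a para-complex structure such that $h(I(x),I(y))=-h(x,y)$ for all $x,y$. A hyper Kähler (resp. para-hyper Kähler) structure on $\mathfrak g$ is a quadruple $(h,I_1,I_2,I_3)$ such that $(h,I_1)$ and $(h,I_2)$ are Hermitian (resp. para-Hermitian) structures, $I_3=I_1I_2$, $I_1I_2=-I_2I_1$, and the forms $\omega_i(x,y)=h(I_i(x),y)$,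 $i=1,2,3$, are symplectic structures on $\mathfrak g$.
   Formalization: Formalized for finite-dimensional 𝔤, with I_3 = I_1 I_2 added to the hyper symplectic side: otherwise (2h, I_i/2) has the same ω_i but is not (para-)hyper Kähler. Also proved: a triple is ε-hyper symplectic iff it arises from some (para-)hyper Kähler quadruple. *)

theory Defs
  imports Complex_Main "HOL-Library.Function_Algebras"
begin

definition bilinear_map ::
  "('k::field \<Rightarrow> 'g::ab_group_add \<Rightarrow> 'g) \<Rightarrow> ('k \<Rightarrow> 'w::ab_group_add \<Rightarrow> 'w) \<Rightarrow> ('g \<Rightarrow> 'g \<Rightarrow> 'w) \<Rightarrow> bool"
  where "bilinear_map s t b \<longleftrightarrow>
    (\<forall>x. Vector_Spaces.linear s t (b x)) \<and> (\<forall>y. Vector_Spaces.linear s t (\<lambda>x. b x y))"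

locale lie_algebra = vector_space scale
  for scale :: "'k::field \<Rightarrow> 'g::ab_group_add \<Rightarrow> 'g" +
  fixes bracket :: "'g \<Rightarrow> 'g \<Rightarrow> 'g"
  assumes bracket_bilinear: "bilinear_map scale scale bracket"
    and bracket_alternating: "bracket x x = 0"
    and jacobi: "bracket x (bracket y z) + bracket y (bracket z x) + bracket z (bracket x y) = 0"

abbreviation bilinear_form ::
  "('k::field \<Rightarrow> 'g::ab_group_add \<Rightarrow> 'g) \<Rightarrow> ('g \<Rightarrow> 'g \<Rightarrow> 'k) \<Rightarrow> bool"
  where "bilinear_form s \<equiv> bilinear_map s (*)"

definition nondegenerate :: "('g::zero \<Rightarrow> 'g \<Rightarrow> 'k::zero) \<Rightarrow> bool"
  where "nondegenerate b \<longleftrightarrow> (\<forall>x. (\<forall>y. b x y = 0) \<longrightarrow> x = 0)"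

definition two_form ::
  "('k::field \<Rightarrow> 'g::ab_group_add \<Rightarrow> 'g) \<Rightarrow> ('g \<Rightarrow> 'g \<Rightarrow> 'k) \<Rightarrow> bool"
  where "two_form s \<omega> \<longleftrightarrow> bilinear_form s \<omega> \<and> (\<forall>x. \<omega> x x = 0)"

definition symplectic_structure ::
  "('k::field \<Rightarrow> 'g::ab_group_add \<Rightarrow> 'g) \<Rightarrow> ('g \<Rightarrow> 'g \<Rightarrow> 'g) \<Rightarrow> ('g \<Rightarrow> 'g \<Rightarrow> 'k) \<Rightarrow> bool"
  where "symplectic_structure s br \<omega> \<longleftrightarrow>
    two_form s \<omega> \<and> nondegenerate \<omega> \<and>
    (\<forall>x y z. \<omega> (br x y) z + \<omega> (br z x) y + \<omega> (br y z) x = 0)"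

text \<open>A representation space is a subspace \<open>V\<close> of the vector space on the type \<open>'v\<close>, so that the
  dual of \<open>'g\<close> can be taken inside the type \<open>'g \<Rightarrow> 'k\<close> of all functions, with pointwise operations.\<close>

definition lie_representation ::
  "('k::field \<Rightarrow> 'g::ab_group_add \<Rightarrow> 'g) \<Rightarrow> ('g \<Rightarrow> 'g \<Rightarrow> 'g) \<Rightarrow>
   ('k \<Rightarrow> 'v::ab_group_add \<Rightarrow> 'v) \<Rightarrow> 'v set \<Rightarrow> ('g \<Rightarrow> 'v \<Rightarrow> 'v) \<Rightarrow> bool"
  where "lie_representation s br t V \<rho> \<longleftrightarrow>
    vector_space t \<and> module.subspace t V \<and>
    (\<forall>x. \<forall>v\<in>V. \<rho> x v \<in> V) \<and>
    (\<forall>x. \<forall>v\<in>V. \<forall>w\<in>V. \<rho> x (v + w) = \<rho> x v + \<rho> x w) \<and>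
    (\<forall>x c. \<forall>v\<in>V. \<rho> x (t c v) = t c (\<rho> x v)) \<and>
    (\<forall>v\<in>V. Vector_Spaces.linear s t (\<lambda>x. \<rho> x v)) \<and>
    (\<forall>x y. \<forall>v\<in>V. \<rho> (br x y) v = \<rho> x (\<rho> y v) - \<rho> y (\<rho> x v))"

definition relative_differential_operator ::
  "('k::field \<Rightarrow> 'g::ab_group_add \<Rightarrow> 'g) \<Rightarrow> ('g \<Rightarrow> 'g \<Rightarrow> 'g) \<Rightarrow>
   ('k \<Rightarrow> 'v::ab_group_add \<Rightarrow> 'v) \<Rightarrow> 'v set \<Rightarrow> ('g \<Rightarrow> 'v \<Rightarrow> 'v) \<Rightarrow> ('g \<Rightarrow> 'v) \<Rightarrow> bool"
  where "relative_differential_operator s br t V \<rho> d \<longleftrightarrow>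
    lie_representation s br t V \<rho> \<and>
    Vector_Spaces.linear s t d \<and> range d \<subseteq> V \<and>
    (\<forall>x y. d (br x y) = \<rho> x (d y) - \<rho> y (d x))"

text \<open>Below, \<open>inv d\<close> is only applied to elements of \<open>V = range d\<close>, where it is the inverse of the
  bijection \<open>d\<close> from \<open>'g\<close> onto \<open>V\<close>; outside \<open>V\<close> its values are arbitrary.\<close>

definition hyper_relative_differential_operator ::
  "('k::field \<Rightarrow> 'g::ab_group_add \<Rightarrow> 'g) \<Rightarrow> ('g \<Rightarrow> 'g \<Rightarrow> 'g) \<Rightarrow>
   ('k \<Rightarrow> 'v::ab_group_add \<Rightarrow> 'v) \<Rightarrow> 'v set \<Rightarrow> ('g \<Rightarrow> 'v \<Rightarrow> 'v) \<Rightarrow>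
   'k \<Rightarrow> 'k \<Rightarrow> 'k \<Rightarrow> ('g \<Rightarrow> 'v) \<Rightarrow> ('g \<Rightarrow> 'v) \<Rightarrow> ('g \<Rightarrow> 'v) \<Rightarrow> bool"
  where "hyper_relative_differential_operator s br t V \<rho> \<epsilon>1 \<epsilon>2 \<epsilon>3 d1 d2 d3 \<longleftrightarrow>
    \<epsilon>1 \<in> {1, -1} \<and> \<epsilon>2 \<in> {1, -1} \<and> \<epsilon>3 \<in> {1, -1} \<and>
    (\<forall>d \<in> {d1, d2, d3}. relative_differential_operator s br t V \<rho> d \<and> bij_betw d UNIV V) \<and>
    (inv d3 \<circ> d2) ^^ 2 = s \<epsilon>1 \<and>
    (inv d1 \<circ> d3) ^^ 2 = s \<epsilon>2 \<and>
    (inv d2 \<circ> d1) ^^ 2 = s \<epsilon>3"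

definition dual_scale :: "'k::field \<Rightarrow> ('g \<Rightarrow> 'k) \<Rightarrow> ('g \<Rightarrow> 'k)"
  where "dual_scale c \<xi> = (\<lambda>y. c * \<xi> y)"

definition dual_space :: "('k::field \<Rightarrow> 'g::ab_group_add \<Rightarrow> 'g) \<Rightarrow> ('g \<Rightarrow> 'k) set"
  where "dual_space s = {\<xi>. Vector_Spaces.linear s (*) \<xi>}"

definition coadjoint :: "('g \<Rightarrow> 'g \<Rightarrow> 'g) \<Rightarrow> 'g \<Rightarrow> ('g \<Rightarrow> 'k::field) \<Rightarrow> ('g \<Rightarrow> 'k)"
  where "coadjoint br x \<xi> = (\<lambda>y. - \<xi> (br x y))"

text \<open>The map \<open>x \<mapsto> \<omega>(x, -)\<close> from \<open>'g\<close> to its dual is the curried function \<open>\<omega>\<close> itself.\<close>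

definition hyper_symplectic_structure ::
  "('k::field \<Rightarrow> 'g::ab_group_add \<Rightarrow> 'g) \<Rightarrow> ('g \<Rightarrow> 'g \<Rightarrow> 'g) \<Rightarrow> 'k \<Rightarrow> 'k \<Rightarrow> 'k \<Rightarrow>
   ('g \<Rightarrow> 'g \<Rightarrow> 'k) \<Rightarrow> ('g \<Rightarrow> 'g \<Rightarrow> 'k) \<Rightarrow> ('g \<Rightarrow> 'g \<Rightarrow> 'k) \<Rightarrow> bool"
  where "hyper_symplectic_structure s br \<epsilon>1 \<epsilon>2 \<epsilon>3 \<omega>1 \<omega>2 \<omega>3 \<longleftrightarrow>
    symplectic_structure s br \<omega>1 \<and> symplectic_structure s br \<omega>2 \<and> symplectic_structure s br \<omega>3 \<and>
    hyper_relative_differential_operator s br dual_scale (dual_space s) (coadjoint br)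
      \<epsilon>1 \<epsilon>2 \<epsilon>3 \<omega>1 \<omega>2 \<omega>3"

definition nijenhuis_operator ::
  "('k::field \<Rightarrow> 'g::ab_group_add \<Rightarrow> 'g) \<Rightarrow> ('g \<Rightarrow> 'g \<Rightarrow> 'g) \<Rightarrow> ('g \<Rightarrow> 'g) \<Rightarrow> bool"
  where "nijenhuis_operator s br N \<longleftrightarrow>
    Vector_Spaces.linear s s N \<and>
    (\<forall>x y. br (N x) (N y) = N (br (N x) y + br x (N y) - N (br x y)))"

definition complex_structure ::
  "('k::field \<Rightarrow> 'g::ab_group_add \<Rightarrow> 'g) \<Rightarrow> ('g \<Rightarrow> 'g \<Rightarrow> 'g) \<Rightarrow> ('g \<Rightarrow> 'g) \<Rightarrow> bool"
  where "complex_structure s br N \<longleftrightarrow> nijenhuis_operator s br N \<and> (\<forall>x. N (N x) = - x)"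

definition para_complex_structure ::
  "('k::field \<Rightarrow> 'g::ab_group_add \<Rightarrow> 'g) \<Rightarrow> ('g \<Rightarrow> 'g \<Rightarrow> 'g) \<Rightarrow> ('g \<Rightarrow> 'g) \<Rightarrow> bool"
  where "para_complex_structure s br N \<longleftrightarrow> nijenhuis_operator s br N \<and> (\<forall>x. N (N x) = x)"

definition pseudo_metric ::
  "('k::field \<Rightarrow> 'g::ab_group_add \<Rightarrow> 'g) \<Rightarrow> ('g \<Rightarrow> 'g \<Rightarrow> 'k) \<Rightarrow> bool"
  where "pseudo_metric s h \<longleftrightarrow>
    bilinear_form s h \<and> (\<forall>x y. h x y = h y x) \<and> nondegenerate h"

definition hermitian_structure ::
  "('k::field \<Rightarrow> 'g::ab_group_add \<Rightarrow> 'g) \<Rightarrow> ('g \<Rightarrow> 'g \<Rightarrow> 'g) \<Rightarrow> ('g \<Rightarrow> 'g \<Rightarrow> 'k) \<Rightarrow> ('g \<Rightarrow> 'g) \<Rightarrow> bool"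
  where "hermitian_structure s br h I \<longleftrightarrow>
    pseudo_metric s h \<and> complex_structure s br I \<and> (\<forall>x y. h (I x) (I y) = h x y)"

definition para_hermitian_structure ::
  "('k::field \<Rightarrow> 'g::ab_group_add \<Rightarrow> 'g) \<Rightarrow> ('g \<Rightarrow> 'g \<Rightarrow> 'g) \<Rightarrow> ('g \<Rightarrow> 'g \<Rightarrow> 'k) \<Rightarrow> ('g \<Rightarrow> 'g) \<Rightarrow> bool"
  where "para_hermitian_structure s br h I \<longleftrightarrow>
    pseudo_metric s h \<and> para_complex_structure s br I \<and> (\<forall>x y. h (I x) (I y) = - h x y)"

definition fundamental_form :: "('g \<Rightarrow> 'g \<Rightarrow> 'k) \<Rightarrow> ('g \<Rightarrow> 'g) \<Rightarrow> 'g \<Rightarrow> 'g \<Rightarrow> 'k"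
  where "fundamental_form h I = (\<lambda>x y. h (I x) y)"

definition hyper_kaehler_structure ::
  "('k::field \<Rightarrow> 'g::ab_group_add \<Rightarrow> 'g) \<Rightarrow> ('g \<Rightarrow> 'g \<Rightarrow> 'g) \<Rightarrow> ('g \<Rightarrow> 'g \<Rightarrow> 'k) \<Rightarrow>
   ('g \<Rightarrow> 'g) \<Rightarrow> ('g \<Rightarrow> 'g) \<Rightarrow> ('g \<Rightarrow> 'g) \<Rightarrow> bool"
  where "hyper_kaehler_structure s br h I1 I2 I3 \<longleftrightarrow>
    hermitian_structure s br h I1 \<and> hermitian_structure s br h I2 \<and>
    I3 = I1 \<circ> I2 \<and> (\<forall>x. I1 (I2 x) = - I2 (I1 x)) \<and>
    (\<forall>I \<in> {I1, I2, I3}. symplectic_structure s br (fundamental_form h I))"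

definition para_hyper_kaehler_structure ::
  "('k::field \<Rightarrow> 'g::ab_group_add \<Rightarrow> 'g) \<Rightarrow> ('g \<Rightarrow> 'g \<Rightarrow> 'g) \<Rightarrow> ('g \<Rightarrow> 'g \<Rightarrow> 'k) \<Rightarrow>
   ('g \<Rightarrow> 'g) \<Rightarrow> ('g \<Rightarrow> 'g) \<Rightarrow> ('g \<Rightarrow> 'g) \<Rightarrow> bool"
  where "para_hyper_kaehler_structure s br h I1 I2 I3 \<longleftrightarrow>
    para_hermitian_structure s br h I1 \<and> para_hermitian_structure s br h I2 \<and>
    I3 = I1 \<circ> I2 \<and> (\<forall>x. I1 (I2 x) = - I2 (I1 x)) \<and>
    (\<forall>I \<in> {I1, I2, I3}. symplectic_structure s br (fundamental_form h I))"

end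

theory Submission
  imports Defs
begin

text \<open>
  Write \<open>\<epsilon>\<close> for \<open>-1\<close> in the hyper Kaehler case and for \<open>1\<close> in the para-hyper Kaehler case; both
  cases are the same argument for \<open>(\<epsilon>, \<epsilon>, -1)\<close>, and \<open>\<epsilon>\<^sup>2 = 1\<close> is the property of \<open>\<epsilon>\<close> that
  makes the signs cancel.

  A closed form is the same as a relative differential operator for the coadjoint representation,
  and on a finite-dimensional space nondegenerate is the same as invertible. So an \<open>\<epsilon>\<close>-hyper
  symplectic structure consists of three symplectic forms linked by recursion operators
  \<open>\<omega>\<^sub>2 = \<omega>\<^sub>3 \<circ> N\<^sub>1\<close>, \<open>\<omega>\<^sub>3 = \<omega>\<^sub>1 \<circ> N\<^sub>2\<close>, \<open>\<omega>\<^sub>1 = \<omega>\<^sub>2 \<circ> N\<^sub>3\<close> (in the first argument) with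
  prescribed squares (\<open>hyper_symplectic_iff_recursion\<close>). If \<open>\<omega>\<^sub>i = h \<circ> I\<^sub>i\<close> and \<open>I\<^sub>3 = I\<^sub>1 I\<^sub>2\<close>, then
  \<open>N\<^sub>1 = -\<epsilon> I\<^sub>1\<close>, \<open>N\<^sub>2 = I\<^sub>2\<close> and \<open>N\<^sub>3 = -\<epsilon> I\<^sub>3\<close>, so the conditions on the squares
  are the (para-)quaternion relations, and conversely. Given these relations, skew-symmetry of all
  three forms makes \<open>h\<close> symmetric, and then skew-symmetry of \<open>\<omega>\<^sub>1\<close> and \<open>\<omega>\<^sub>2\<close> is the compatibility of
  \<open>h\<close> with \<open>I\<^sub>1\<close> and \<open>I\<^sub>2\<close>.

  What remains is integrability, which is where the Lie bracket enters: if two symplectic forms are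
  linked by an operator \<open>N\<close> whose square is a scalar, then \<open>N\<close> is a Nijenhuis operator
  (\<open>recursion_operator_nijenhuis\<close>). Finally, every \<open>\<epsilon>\<close>-hyper symplectic triple comes from a
  quadruple: take \<open>I\<^sub>1 = -\<epsilon> N\<^sub>1\<close>, \<open>I\<^sub>2 = N\<^sub>2\<close> and \<open>h = \<omega>\<^sub>1 \<circ> I\<^sub>1\<^sup>-\<^sup>1\<close>. Only \<open>\<epsilon> = \<plusminus>1\<close> is divided by,
  so the field may have any characteristic.
\<close>

section \<open>Bilinear forms and the dual space\<close>

lemma vector_space_field: "vector_space ((*) :: 'k::field \<Rightarrow> 'k \<Rightarrow> 'k)"
  by unfold_locales (auto simp: algebra_simps)

lemma vector_space_dual_scale: "vector_space (dual_scale :: 'k::field \<Rightarrow> ('g \<Rightarrow> 'k) \<Rightarrow> ('g \<Rightarrow> 'k))"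
  by unfold_locales (auto simp: dual_scale_def fun_eq_iff algebra_simps)

lemma (in vector_space) bilinear_form_iff:
  "bilinear_form scale b \<longleftrightarrow>
    (\<forall>x y z. b x (y + z) = b x y + b x z) \<and> (\<forall>x c y. b x (scale c y) = c * b x y) \<and>
    (\<forall>x y z. b (x + y) z = b x z + b y z) \<and> (\<forall>c x y. b (scale c x) y = c * b x y)"
  using vector_space_field vector_space_axioms
  by (auto simp: bilinear_map_def Vector_Spaces.linear_iff)

lemma (in vector_space) bilinear_formD:
  assumes "bilinear_form scale b"
  shows "b x (y + z) = b x y + b x z" "b (x + y) z = b x z + b y z"
    "b x (scale c y) = c * b x y" "b (scale c x) y = c * b x y"
    "b x (- y) = - b x y" "b (- x) y = - b x y"
    "b x (y - z) = b x y - b x z" "b (x - y) z = b x z - b y z"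
    "b x 0 = 0" "b 0 y = 0"
proof -
  show add: "b x (y + z) = b x y + b x z" "b (x + y) z = b x z + b y z" for x y z
    using assms by (auto simp: bilinear_form_iff)
  show sc: "b x (scale c y) = c * b x y" "b (scale c x) y = c * b x y" for c x y
    using assms by (auto simp: bilinear_form_iff)
  show um: "b x (- y) = - b x y" "b (- x) y = - b x y" for x y
    using sc(1)[where c = "-1"] sc(2)[where c = "-1"] by simp_all
  show "b x (y - z) = b x y - b x z" "b (x - y) z = b x z - b y z"
    using add(1)[where z = "- z"] add(2)[where y = "- y"] by (simp_all add: um)
  show "b x 0 = 0" "b 0 y = 0"
    using sc(1)[where c = 0 and y = 0] sc(2)[where c = 0 and x = 0] by simp_all
qed

lemma (in vector_space) nondegenerate_cancel:
  assumes "bilinear_form scale b" "nondegenerate b" "b x = b y"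
  shows "x = y"
proof -
  have "b (x - y) z = 0" for z
    using assms(3) by (simp add: bilinear_formD[OF assms(1)])
  then have "x - y = 0"
    using assms(2) unfolding nondegenerate_def by blast
  then show ?thesis
    by simp
qed

lemma (in vector_space) bilinear_form_in_dual:
  assumes "bilinear_form scale b"
  shows "b x \<in> dual_space scale"
  using assms by (simp add: dual_space_def bilinear_map_def)

lemma (in vector_space) bilinear_form_linear_dual:
  assumes "bilinear_form scale b"
  shows "Vector_Spaces.linear scale dual_scale b"
  using vector_space_axioms vector_space_dual_scale
  by (auto simp: Vector_Spaces.linear_iff bilinear_formD[OF assms] dual_scale_def fun_eq_iff)

text \<open>The dual is a set of functions rather than a type with a dimension, so instead of comparing
  dimensions one composes \<open>b\<close> with the coordinate isomorphism \<open>\<xi> \<mapsto> \<Sum>v. \<xi>(v) v\<close> from the dual back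
  to the space. The composite is an injective endomorphism, hence surjective.\<close>

lemma (in finite_dimensional_vector_space) nondegenerate_bij_dual:
  assumes b: "bilinear_form scale b" and nd: "nondegenerate b"
  shows "bij_betw b UNIV (dual_space scale)"
proof -
  define C where "C \<xi> = (\<Sum>v\<in>Basis. scale (\<xi> v) v)" for \<xi> :: "'b \<Rightarrow> 'a"
  have coords: "\<xi> = \<eta>" if "C \<xi> = C \<eta>" "\<xi> \<in> dual_space scale" "\<eta> \<in> dual_space scale" for \<xi> \<eta>
  proof -
    have "(\<Sum>v\<in>Basis. scale (\<xi> v - \<eta> v) v) = 0"
      using that(1) by (simp add: C_def scale_left_diff_distrib sum_subtractf)
    then have "\<xi> v = \<eta> v" if "v \<in> Basis" for v
      using independentD[OF independent_Basis finite_Basis order_refl, of "\<lambda>v. \<xi> v - \<eta> v"] that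
      by simp
    moreover have "vector_space_pair scale ((*) :: 'a \<Rightarrow> 'a \<Rightarrow> 'a)"
      using vector_space_axioms vector_space_field by (simp add: vector_space_pair_def)
    ultimately show ?thesis
      using vector_space_pair.linear_eq_on[of scale "(*)" \<xi> \<eta> _ Basis] that(2,3) span_Basis
      by (auto simp: dual_space_def)
  qed
  have inj: "inj b"
    using nondegenerate_cancel[OF b nd] by (auto intro: injI)
  have "Vector_Spaces.linear scale scale (C \<circ> b)"
    using vector_space_axioms
    by (simp add: Vector_Spaces.linear_iff C_def bilinear_formD[OF b] scale_left_distrib sum.distrib
        scale_sum_right)
  moreover have "inj (C \<circ> b)"
    using coords bilinear_form_in_dual[OF b] injD[OF inj] by (auto intro!: injI)
  ultimately have surj: "surj (C \<circ> b)"
    by (rule linear_inj_imp_surj)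
  have "\<xi> \<in> range b" if "\<xi> \<in> dual_space scale" for \<xi>
  proof -
    obtain x where "C \<xi> = C (b x)"
      using surjD[OF surj, of "C \<xi>"] by auto
    then show ?thesis
      using coords that bilinear_form_in_dual[OF b] by auto
  qed
  then show ?thesis
    using inj bilinear_form_in_dual[OF b] by (auto simp: bij_betw_def)
qed

section \<open>Symplectic forms as relative differential operators\<close>

context lie_algebra
begin

lemma bracket_add: "bracket x (y + z) = bracket x y + bracket x z"
    "bracket (x + y) z = bracket x z + bracket y z"
  and bracket_scale: "bracket x (scale c y) = scale c (bracket x y)"
    "bracket (scale c x) y = scale c (bracket x y)"
  using bracket_bilinear by (auto simp: bilinear_map_def Vector_Spaces.linear_iff)

lemma bracket_skew: "bracket y x = - bracket x y"
proof -
  have "bracket (x + y) (x + y) = bracket x y + bracket y x"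
    unfolding bracket_add by (simp add: bracket_alternating)
  then have "bracket x y + bracket y x = 0"
    by (metis bracket_alternating)
  then show ?thesis
    by (simp add: minus_unique)
qed

lemma bracket_uminus: "bracket x (- y) = - bracket x y" "bracket (- x) y = - bracket x y"
  using bracket_scale(1)[where c = "-1"] bracket_scale(2)[where c = "-1"] by simp_all

lemma coadjoint_representation:
  "lie_representation scale bracket dual_scale (dual_space scale) (coadjoint bracket)"
proof -
  have dual: "\<xi> \<in> dual_space scale \<longleftrightarrow>
      (\<forall>x y. \<xi> (x + y) = \<xi> x + \<xi> y) \<and> (\<forall>c x. \<xi> (scale c x) = c * \<xi> x)" for \<xi>
    using vector_space_axioms
    by (simp add: dual_space_def Vector_Spaces.linear_iff vector_space_field)
  have jac: "bracket (bracket x y) z = bracket x (bracket y z) - bracket y (bracket x z)" for x y z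
    using jacobi[of x y z]
    by (simp add: bracket_skew[of "bracket x y" z] bracket_skew[of z x] bracket_uminus
        algebra_simps)
  have minus: "\<xi> (x - y) = \<xi> x - \<xi> y" if "\<xi> \<in> dual_space scale" for \<xi> x y
    by (metis that dual add_diff_cancel diff_add_cancel)
  have "module.subspace dual_scale (dual_space scale)"
    using vector_space_dual_scale
    by (subst module.subspace_def)
      (auto simp: dual module_iff_vector_space dual_scale_def algebra_simps)
  moreover have "Vector_Spaces.linear scale dual_scale (\<lambda>x. coadjoint bracket x \<xi>)"
    if "\<xi> \<in> dual_space scale" for \<xi>
    using that vector_space_axioms vector_space_dual_scale
    by (auto simp: Vector_Spaces.linear_iff dual coadjoint_def dual_scale_def bracket_add bracket_scale fun_eq_iff)
  moreover have "coadjoint bracket (bracket x y) \<xi> =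
      coadjoint bracket x (coadjoint bracket y \<xi>) - coadjoint bracket y (coadjoint bracket x \<xi>)"
    if "\<xi> \<in> dual_space scale" for x y \<xi>
    by (auto simp: coadjoint_def jac minus[OF that] fun_eq_iff)
  ultimately show ?thesis
    using vector_space_dual_scale
    by (auto simp: lie_representation_def dual coadjoint_def dual_scale_def bracket_add
        bracket_scale algebra_simps fun_eq_iff)
qed

lemma symplecticD:
  assumes "symplectic_structure scale bracket \<omega>"
  shows "bilinear_form scale \<omega>" "nondegenerate \<omega>"
    "\<omega> (bracket x y) z + \<omega> (bracket z x) y + \<omega> (bracket y z) x = 0"
  using assms by (auto simp: symplectic_structure_def two_form_def)

lemma symplectic_skew:
  assumes "symplectic_structure scale bracket \<omega>"
  shows "\<omega> y x = - \<omega> x y"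
proof -
  have alt: "\<omega> z z = 0" for z
    using assms by (simp add: symplectic_structure_def two_form_def)
  have "\<omega> (x + y) (x + y) = \<omega> x y + \<omega> y x"
    unfolding bilinear_formD(1,2)[OF symplecticD(1)[OF assms]] by (simp add: alt)
  then have "\<omega> x y + \<omega> y x = 0"
    by (metis alt)
  then show ?thesis
    by (simp add: minus_unique)
qed

lemma symplectic_relative_differential_operator:
  assumes "symplectic_structure scale bracket \<omega>"
  shows "relative_differential_operator scale bracket dual_scale (dual_space scale)
    (coadjoint bracket) \<omega>"
proof -
  note bl = symplecticD(1)[OF assms]
  have "\<omega> (bracket x y) z = - \<omega> y (bracket x z) + \<omega> x (bracket y z)" for x y z
    using symplecticD(3)[OF assms, of x y z] bracket_skew[of z x]
      symplectic_skew[OF assms, of "bracket x z" y] symplectic_skew[OF assms, of "bracket y z" x]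
    by (simp add: bilinear_formD[OF bl] algebra_simps eq_neg_iff_add_eq_0)
  then have "\<omega> (bracket x y) = coadjoint bracket x (\<omega> y) - coadjoint bracket y (\<omega> x)" for x y
    by (auto simp: coadjoint_def fun_eq_iff)
  then show ?thesis
    using bilinear_form_linear_dual[OF bl] bilinear_form_in_dual[OF bl]
    by (auto simp: relative_differential_operator_def coadjoint_representation)
qed

section \<open>Recursion operators are Nijenhuis operators\<close>

text \<open>Linearity comes for free, because \<open>\<omega>\<close> is injective.\<close>

lemma recursion_operator_linear:
  assumes \<omega>: "symplectic_structure scale bracket \<omega>" and \<eta>: "symplectic_structure scale bracket \<eta>"
    and N: "\<And>x. \<eta> x = \<omega> (N x)"
  shows "Vector_Spaces.linear scale scale N"
proof -
  note bl = bilinear_formD[OF symplecticD(1)[OF \<omega>]] bilinear_formD[OF symplecticD(1)[OF \<eta>]]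
  note cancel = nondegenerate_cancel[OF symplecticD(1,2)[OF \<omega>]]
  have "N (x + y) = N x + N y" for x y
    by (rule cancel) (simp add: fun_eq_iff bl flip: N)
  moreover have "N (scale c x) = scale c (N x)" for c x
    by (rule cancel) (simp add: fun_eq_iff bl flip: N)
  ultimately show ?thesis
    using vector_space_axioms by (simp add: Vector_Spaces.linear_iff)
qed

text \<open>The closedness of \<open>\<omega>\<close> at \<open>(N x, N y, z)\<close> contains two terms with an operator in the second
  slot; moving it across turns them into values of \<open>\<eta>\<close>, which the closedness of \<open>\<eta>\<close> at
  \<open>(N x, y, z)\<close> and \<open>(x, N y, z)\<close> rewrites. Since \<open>N\<^sup>2\<close> is a scalar, what is left over is a
  multiple of the closedness of \<open>\<omega>\<close> at \<open>(x, y, z)\<close>.\<close>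

lemma recursion_operator_nijenhuis:
  assumes \<omega>: "symplectic_structure scale bracket \<omega>" and \<eta>: "symplectic_structure scale bracket \<eta>"
    and N: "\<And>x. \<eta> x = \<omega> (N x)" and square: "\<And>x. N (N x) = scale e x"
  shows "nijenhuis_operator scale bracket N"
proof -
  interpret N: Vector_Spaces.linear scale scale N
    by (rule recursion_operator_linear[OF \<omega> \<eta> N])
  note bl = bilinear_formD[OF symplecticD(1)[OF \<omega>]]
  have move: "\<omega> x (N y) = \<eta> x y" for x y
    using symplectic_skew[OF \<omega>, of x "N y"] symplectic_skew[OF \<eta>, of x y] by (simp add: N)
  have \<eta>N: "\<eta> x (N y) = e * \<omega> x y" for x y
    by (simp add: N move) (simp add: square bl flip: N)
  have "bracket (N x) (N y) = N (bracket (N x) y + bracket x (N y) - N (bracket x y))" for x y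
  proof (rule nondegenerate_cancel[OF symplecticD(1,2)[OF \<omega>]], rule ext)
    fix z
    \<comment> \<open>Closedness of \<open>\<omega>\<close> and \<open>\<eta>\<close> at the four triples, with \<open>N\<close> moved out of the second slot.\<close>
    have "\<omega> (bracket (N x) (N y)) z + \<eta> (bracket z (N x)) y + \<eta> (bracket (N y) z) x = 0"
      using symplecticD(3)[OF \<omega>, of "N x" "N y" z] by (simp only: move)
    moreover have "\<eta> (bracket (N x) y) z + \<eta> (bracket z (N x)) y + e * \<omega> (bracket y z) x = 0"
      using symplecticD(3)[OF \<eta>, of "N x" y z] by (simp only: \<eta>N)
    moreover have "\<eta> (bracket x (N y)) z + e * \<omega> (bracket z x) y + \<eta> (bracket (N y) z) x = 0"
      using symplecticD(3)[OF \<eta>, of x "N y" z] by (simp only: \<eta>N)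
    moreover have "e * \<omega> (bracket x y) z + e * \<omega> (bracket z x) y + e * \<omega> (bracket y z) x = 0"
      using symplecticD(3)[OF \<omega>, of x y z] by (simp flip: distrib_left)
    ultimately have "\<omega> (bracket (N x) (N y)) z =
        \<eta> (bracket (N x) y) z + \<eta> (bracket x (N y)) z - e * \<omega> (bracket x y) z"
      by algebra
    then show "\<omega> (bracket (N x) (N y)) z =
        \<omega> (N (bracket (N x) y + bracket x (N y) - N (bracket x y))) z"
      by (simp add: N.add N.diff square bl N)
  qed
  then show ?thesis
    using N.linear_axioms by (simp add: nijenhuis_operator_def)
qed

lemma nijenhuis_operator_uminus:
  assumes "nijenhuis_operator scale bracket N"
  shows "nijenhuis_operator scale bracket (\<lambda>x. - N x)"
proof -
  interpret N: Vector_Spaces.linear scale scale N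
    using assms by (simp add: nijenhuis_operator_def)
  have "bracket (N x) (N y) = N (bracket (N x) y + bracket x (N y) - N (bracket x y))" for x y
    using assms by (simp add: nijenhuis_operator_def)
  then show ?thesis
    using vector_space_axioms
    by (simp add: nijenhuis_operator_def Vector_Spaces.linear_iff bracket_uminus N.add N.diff N.neg
        N.scale)
qed

end

section \<open>Hyper symplectic triples and (para-)hyper Kaehler quadruples\<close>

text \<open>The common form of the two definitions, with \<open>e = -1\<close> for hyper Kaehler and \<open>e = 1\<close> for
  para-hyper Kaehler.\<close>

definition signed_hyper_kaehler ::
  "('k::field \<Rightarrow> 'g::ab_group_add \<Rightarrow> 'g) \<Rightarrow> ('g \<Rightarrow> 'g \<Rightarrow> 'g) \<Rightarrow> 'k \<Rightarrow> ('g \<Rightarrow> 'g \<Rightarrow> 'k) \<Rightarrow>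
   ('g \<Rightarrow> 'g) \<Rightarrow> ('g \<Rightarrow> 'g) \<Rightarrow> ('g \<Rightarrow> 'g) \<Rightarrow> bool"
  where "signed_hyper_kaehler s br e h I1 I2 I3 \<longleftrightarrow>
    pseudo_metric s h \<and>
    (\<forall>I \<in> {I1, I2}. nijenhuis_operator s br I \<and> (\<forall>x. I (I x) = s e x) \<and>
      (\<forall>x y. h (I x) (I y) = - e * h x y)) \<and>
    I3 = I1 \<circ> I2 \<and> (\<forall>x. I1 (I2 x) = - I2 (I1 x)) \<and>
    (\<forall>I \<in> {I1, I2, I3}. symplectic_structure s br (fundamental_form h I))"

locale finite_dimensional_lie_algebra =
  lie_algebra scale bracket + finite_dimensional_vector_space scale Basis
  for scale :: "'k::field \<Rightarrow> 'g::ab_group_add \<Rightarrow> 'g" and bracket and Basis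
begin

lemma hyper_kaehler_iff_signed:
  "hyper_kaehler_structure scale bracket h I1 I2 I3 \<longleftrightarrow>
    signed_hyper_kaehler scale bracket (-1) h I1 I2 I3"
  by (auto simp: hyper_kaehler_structure_def signed_hyper_kaehler_def hermitian_structure_def
      complex_structure_def)

lemma para_hyper_kaehler_iff_signed:
  "para_hyper_kaehler_structure scale bracket h I1 I2 I3 \<longleftrightarrow>
    signed_hyper_kaehler scale bracket 1 h I1 I2 I3"
  by (auto simp: para_hyper_kaehler_structure_def signed_hyper_kaehler_def
      para_hermitian_structure_def para_complex_structure_def)

lemma hyper_symplectic_iff_recursion:
  "hyper_symplectic_structure scale bracket e1 e2 e3 \<omega>1 \<omega>2 \<omega>3 \<longleftrightarrow>
    e1 \<in> {1, -1} \<and> e2 \<in> {1, -1} \<and> e3 \<in> {1, -1} \<and>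
    (\<forall>\<omega> \<in> {\<omega>1, \<omega>2, \<omega>3}. symplectic_structure scale bracket \<omega>) \<and>
    (\<exists>N1 N2 N3.
      (\<forall>x. \<omega>2 x = \<omega>3 (N1 x) \<and> \<omega>3 x = \<omega>1 (N2 x) \<and> \<omega>1 x = \<omega>2 (N3 x)) \<and>
      (\<forall>x. N1 (N1 x) = scale e1 x \<and> N2 (N2 x) = scale e2 x \<and> N3 (N3 x) = scale e3 x))"
  (is "?L \<longleftrightarrow> ?E1 \<and> ?E2 \<and> ?E3 \<and> ?S \<and> ?R")
proof (cases ?S)
  case True
  then have s: "symplectic_structure scale bracket \<omega>1" "symplectic_structure scale bracket \<omega>2"
      "symplectic_structure scale bracket \<omega>3"
    by auto
  have bij: "bij_betw \<omega> UNIV (dual_space scale)" if "symplectic_structure scale bracket \<omega>" for \<omega>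
    using nondegenerate_bij_dual symplecticD(1,2)[OF that] by blast
  have L: "?L \<longleftrightarrow> ?E1 \<and> ?E2 \<and> ?E3 \<and> (inv \<omega>3 \<circ> \<omega>2) ^^ 2 = scale e1 \<and> (inv \<omega>1 \<circ> \<omega>3) ^^ 2 = scale e2 \<and>
      (inv \<omega>2 \<circ> \<omega>1) ^^ 2 = scale e3"
    using s by (simp add: hyper_symplectic_structure_def hyper_relative_differential_operator_def
        symplectic_relative_differential_operator bij)
  have recursion: "(\<forall>x. \<eta> x = \<omega> (N x)) \<longleftrightarrow> inv \<omega> \<circ> \<eta> = N"
    if "symplectic_structure scale bracket \<omega>" "symplectic_structure scale bracket \<eta>" for \<omega> \<eta> N
  proof -
    have inj: "inj \<omega>" and "range \<eta> = range \<omega>"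
      using bij[OF that(1)] bij[OF that(2)] by (auto simp: bij_betw_def)
    then have "\<eta> x \<in> range \<omega>" for x
      by blast
    then have "\<eta> x = \<omega> (N x) \<longleftrightarrow> inv \<omega> (\<eta> x) = N x" for x
      using inj by (metis f_inv_into_f inv_f_f)
    then show ?thesis
      by (simp add: fun_eq_iff[of "inv \<omega> \<circ> \<eta>"])
  qed
  have "?R \<longleftrightarrow> (inv \<omega>3 \<circ> \<omega>2) ^^ 2 = scale e1 \<and> (inv \<omega>1 \<circ> \<omega>3) ^^ 2 = scale e2 \<and>
      (inv \<omega>2 \<circ> \<omega>1) ^^ 2 = scale e3"
    unfolding all_conj_distrib recursion[OF s(3,2)] recursion[OF s(1,3)] recursion[OF s(2,1)]
    by (simp add: numeral_2_eq_2 fun_eq_iff[of _ "scale _"])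
  then show ?thesis
    using L True by blast
next
  case False
  then show ?thesis
    by (auto simp: hyper_symplectic_structure_def)
qed

text \<open>The recursion operators are \<open>-\<epsilon> I\<^sub>1\<close>, \<open>I\<^sub>2\<close> and \<open>-\<epsilon> I\<^sub>3\<close>; their squares are read off from the
  (para-)quaternion relations.\<close>

lemma signed_hyper_kaehler_imp_hyper_symplectic:
  assumes e: "e \<in> {1, -1}" and K: "signed_hyper_kaehler scale bracket e h I1 I2 I3"
  shows "hyper_symplectic_structure scale bracket e e (-1)
    (fundamental_form h I1) (fundamental_form h I2) (fundamental_form h I3)"
proof -
  have lin: "Vector_Spaces.linear scale scale I1" "Vector_Spaces.linear scale scale I2"
    and sq: "\<And>x. I1 (I1 x) = scale e x" "\<And>x. I2 (I2 x) = scale e x"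
    and I3: "I3 = I1 \<circ> I2" and anti: "\<And>x. I2 (I1 x) = - I1 (I2 x)"
    and sympl: "\<forall>\<omega> \<in> {fundamental_form h I1, fundamental_form h I2, fundamental_form h I3}.
      symplectic_structure scale bracket \<omega>"
    using K by (auto simp: signed_hyper_kaehler_def nijenhuis_operator_def)
  interpret I1: Vector_Spaces.linear scale scale I1 by fact
  interpret I2: Vector_Spaces.linear scale scale I2 by fact
  have ee: "e * e = 1"
    using e by auto
  note simps = I1.scale I2.scale I1.neg I2.neg sq anti ee
  define N1 N3 where N: "N1 x = scale (- e) (I1 x)" "N3 x = scale (- e) (I3 x)" for x
  have "fundamental_form h I2 x = fundamental_form h I3 (N1 x) \<and>
      fundamental_form h I3 x = fundamental_form h I1 (I2 x) \<and>
      fundamental_form h I1 x = fundamental_form h I2 (N3 x)" for x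
    by (simp add: N fundamental_form_def I3 simps)
  moreover have "N1 (N1 x) = scale e x \<and> I2 (I2 x) = scale e x \<and> N3 (N3 x) = scale (-1) x" for x
    by (simp add: N I3 simps)
  ultimately show ?thesis
    unfolding hyper_symplectic_iff_recursion using e sympl by blast
qed

text \<open>Nondegeneracy of \<open>\<omega>\<^sub>1 = h \<circ> I\<^sub>1\<close> makes \<open>I\<^sub>1\<close> invertible and \<open>h\<close> nondegenerate. Cancelling \<open>h\<close>
  turns the equations for the recursion operators into identities between \<open>I\<^sub>1\<close> and \<open>I\<^sub>2\<close>, and
  \<open>I\<^sub>1\<close> is Nijenhuis because \<open>-I\<^sub>1\<close> is the recursion operator from \<open>\<omega>\<^sub>2\<close> to \<open>\<omega>\<^sub>3\<close>.\<close>

lemma hyper_symplectic_imp_signed_hyper_kaehler: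
  assumes e: "e \<in> {1, -1}" and h: "bilinear_form scale h"
    and I1: "Vector_Spaces.linear scale scale I1" and I2: "Vector_Spaces.linear scale scale I2"
    and I3: "I3 = I1 \<circ> I2"
    and S: "hyper_symplectic_structure scale bracket e e (-1)
      (fundamental_form h I1) (fundamental_form h I2) (fundamental_form h I3)"
  shows "signed_hyper_kaehler scale bracket e h I1 I2 I3"
proof -
  define \<omega>1 \<omega>2 \<omega>3 where \<omega>_def: "\<omega>1 = fundamental_form h I1" "\<omega>2 = fundamental_form h I2"
    "\<omega>3 = fundamental_form h I3"
  interpret I1: Vector_Spaces.linear scale scale I1 by fact
  interpret I2: Vector_Spaces.linear scale scale I2 by fact
  note bl = bilinear_formD[OF h]
  have \<omega>: "\<omega>1 x = h (I1 x)" "\<omega>2 x = h (I2 x)" "\<omega>3 x = h (I1 (I2 x))" for x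
    by (simp_all add: \<omega>_def I3 fundamental_form_def)
  obtain N1 N2 N3 where
    s: "symplectic_structure scale bracket \<omega>1" "symplectic_structure scale bracket \<omega>2"
      "symplectic_structure scale bracket \<omega>3"
    and N: "\<And>x. \<omega>2 x = \<omega>3 (N1 x)" "\<And>x. \<omega>3 x = \<omega>1 (N2 x)" "\<And>x. \<omega>1 x = \<omega>2 (N3 x)"
    and squares: "\<And>x. N1 (N1 x) = scale e x" "\<And>x. N2 (N2 x) = scale e x"
      "\<And>x. N3 (N3 x) = scale (-1) x"
    using S unfolding hyper_symplectic_iff_recursion \<omega>_def[symmetric] by blast
  have sq: "N1 (N1 x) = scale e x" "N2 (N2 x) = scale e x" "N3 (N3 x) = - x" for x
    using squares by simp_all
  have ee: "e * e = 1"
    using e by auto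
  have scale_scale_e: "scale e (scale e x) = x" for x
    by (simp add: ee)
  have "inj I1"
    by (rule injI) (metis \<omega>(1) nondegenerate_cancel symplecticD(1,2) s(1))
  then have surj1: "surj I1"
    by (rule linear_inj_imp_surj[OF I1])
  have nd: "nondegenerate h"
    unfolding nondegenerate_def
  proof (intro allI impI)
    fix x assume "\<forall>y. h x y = 0"
    moreover obtain u where u: "x = I1 u"
      using surjD[OF surj1] by blast
    ultimately have "\<forall>y. \<omega>1 u y = 0"
      by (simp add: \<omega>)
    then have "u = 0"
      using symplecticD(2)[OF s(1)] by (simp add: nondegenerate_def)
    then show "x = 0"
      by (simp add: u I1.zero)
  qed
  note cancel = nondegenerate_cancel[OF h nd]
  have "I1 (I2 x) = I1 (N2 x)" for x
    using N(2)[of x] by (intro cancel) (simp add: \<omega>)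
  then have N2: "N2 = I2"
    using \<open>inj I1\<close> by (auto simp: fun_eq_iff inj_eq)
  have sq2: "I2 (I2 x) = scale e x" for x
    using sq(2)[of x] by (simp add: N2)
  have N1: "I1 (I2 (N1 x)) = I2 x" for x
    using N(1)[of x] by (intro cancel) (simp add: \<omega>)
  have sq1: "I1 (I1 x) = scale e x" for x
  proof -
    \<comment> \<open>\<open>u\<close> is \<open>I\<^sub>2\<^sup>-\<^sup>1 x\<close>, since \<open>I\<^sub>2\<^sup>2 = e\<close>.\<close>
    define u where "u = scale e (I2 x)"
    have u: "I2 u = x"
      by (simp add: u_def I2.scale sq2 scale_scale_e del: scale_scale)
    have "scale e (I1 x) = I1 (I2 (N1 (N1 u)))"
      by (simp add: sq I1.scale I2.scale u)
    also have "\<dots> = I2 (N1 u)"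
      by (rule N1)
    finally have "I1 (scale e (I1 x)) = x"
      by (simp add: N1 u)
    then show ?thesis
      by (metis I1.scale scale_scale_e)
  qed
  have N3: "I2 (N3 x) = I1 x" for x
    using N(3)[of x] by (intro cancel) (simp add: \<omega>)
  have anti: "I1 (I2 x) = - I2 (I1 x)" for x
  proof -
    have N3': "N3 x = scale e (I2 (I1 x))" for x
      by (metis N3 sq2 scale_scale_e)
    have quad: "I2 (I1 (I2 (I1 y))) = - y" for y
      using sq(3)[of y] by (simp add: N3' I1.scale I2.scale ee)
    have "I1 (I2 (I1 y)) = scale e (I2 (- y))" for y
      by (metis quad sq2 scale_scale_e)
    from this[of "scale e (I1 x)"] show ?thesis
      by (simp add: I1.scale I2.scale I2.neg sq1 ee)
  qed
  have flip: "h (I1 x) y = - h (I1 y) x" "h (I2 x) y = - h (I2 y) x"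
    "h (I1 (I2 x)) y = - h (I1 (I2 y)) x" for x y
    using symplectic_skew[OF s(1), of x y] symplectic_skew[OF s(2), of x y]
      symplectic_skew[OF s(3), of x y]
    by (simp_all only: \<omega>)
  have sym: "h x y = h y x" for x y
  proof -
    \<comment> \<open>Both \<open>h(I\<^sub>1 u, I\<^sub>2 v)\<close> and its transpose equal \<open>-\<omega>\<^sub>3(v, u)\<close>; and \<open>I\<^sub>1\<close>, \<open>I\<^sub>2\<close> are surjective.\<close>
    have "h (I1 u) (I2 v) = h (I2 v) (I1 u)" for u v
    proof -
      have "h (I1 u) (I2 v) = - h (I1 (I2 v)) u"
        by (rule flip)
      also have "\<dots> = h (I1 (I2 u)) v"
        by (simp add: flip(3)[of v u])
      also have "\<dots> = h (I2 v) (I1 u)"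
        by (simp add: anti bl flip(2)[of "I1 u" v])
      finally show ?thesis .
    qed
    from this[of "scale e (I1 x)" "scale e (I2 y)"] show ?thesis
      by (simp add: I1.scale I2.scale sq1 sq2 ee)
  qed
  have compat: "h (I x) (I y) = - e * h x y"
    if "\<And>x y. h (I x) y = - h (I y) x" "\<And>x. I (I x) = scale e x" for I x y
    using that(1)[of x "I y"] by (simp add: that(2) bl sym)
  have "nijenhuis_operator scale bracket I2"
    using recursion_operator_nijenhuis[OF s(1,3) N(2) sq(2)] by (simp add: N2)
  moreover have "nijenhuis_operator scale bracket (\<lambda>x. - I1 x)"
  proof (rule recursion_operator_nijenhuis[OF s(2,3)])
    show "\<omega>3 x = \<omega>2 (- I1 x)" for x
      by (simp add: \<omega> anti I2.neg)
    show "- I1 (- I1 x) = scale e x" for x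
      by (simp add: I1.neg sq1)
  qed
  then have "nijenhuis_operator scale bracket I1"
    using nijenhuis_operator_uminus by fastforce
  ultimately show ?thesis
    using s sq1 sq2 anti I3 h nd sym compat[OF flip(1) sq1] compat[OF flip(2) sq2]
    by (auto simp: signed_hyper_kaehler_def pseudo_metric_def \<omega>_def)
qed

text \<open>Going around the triangle of forms gives \<open>N\<^sub>3 N\<^sub>2 N\<^sub>1 = 1\<close>, and with the squares this
  fixes all products of the \<open>N\<^sub>i\<close>. For \<open>I\<^sub>1 = -\<epsilon> N\<^sub>1\<close> the metric \<open>\<omega>\<^sub>1 \<circ> I\<^sub>1\<^sup>-\<^sup>1\<close> is \<open>-\<omega>\<^sub>1 \<circ> N\<^sub>1\<close>.\<close>

lemma hyper_symplectic_imp_fundamental_forms: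
  assumes e: "e \<in> {1, -1}"
    and S: "hyper_symplectic_structure scale bracket e e (-1) \<omega>1 \<omega>2 \<omega>3"
  obtains h I1 I2 I3 where "signed_hyper_kaehler scale bracket e h I1 I2 I3"
    "\<omega>1 = fundamental_form h I1" "\<omega>2 = fundamental_form h I2" "\<omega>3 = fundamental_form h I3"
proof -
  obtain N1 N2 N3 where
    s: "symplectic_structure scale bracket \<omega>1" "symplectic_structure scale bracket \<omega>2"
      "symplectic_structure scale bracket \<omega>3"
    and N: "\<And>x. \<omega>2 x = \<omega>3 (N1 x)" "\<And>x. \<omega>3 x = \<omega>1 (N2 x)" "\<And>x. \<omega>1 x = \<omega>2 (N3 x)"
    and squares: "\<And>x. N1 (N1 x) = scale e x" "\<And>x. N2 (N2 x) = scale e x"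
      "\<And>x. N3 (N3 x) = scale (-1) x"
    using S unfolding hyper_symplectic_iff_recursion by blast
  have sq: "N1 (N1 x) = scale e x" "N2 (N2 x) = scale e x" "N3 (N3 x) = - x" for x
    using squares by simp_all
  have ee: "e * e = 1"
    using e by auto
  have lin1: "Vector_Spaces.linear scale scale N1"
    by (rule recursion_operator_linear[OF s(3,2) N(1)])
  interpret N1: Vector_Spaces.linear scale scale N1 by fact
  have lin2: "Vector_Spaces.linear scale scale N2"
    by (rule recursion_operator_linear[OF s(1,3) N(2)])
  define h I1 where "h x = \<omega>1 (- N1 x)" and "I1 x = scale (- e) (N1 x)" for x
  have linI1: "Vector_Spaces.linear scale scale I1"
    using vector_space_axioms
    by (simp add: Vector_Spaces.linear_iff I1_def N1.add N1.scale scale_right_distrib mult.commute)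
  note bl = bilinear_formD[OF symplecticD(1)[OF s(1)]]
  have h: "bilinear_form scale h"
    by (simp add: bilinear_form_iff h_def bl N1.add N1.scale algebra_simps)
  have cycle: "N3 (N2 (N1 x)) = x" for x
    by (rule nondegenerate_cancel[OF symplecticD(1,2)[OF s(2)]]) (metis N)
  interpret N2: Vector_Spaces.linear scale scale N2 by fact
  \<comment> \<open>\<open>N\<^sub>3\<close> and \<open>N\<^sub>1 N\<^sub>2\<close> are both inverse to \<open>N\<^sub>2 N\<^sub>1\<close>.\<close>
  have N1N2: "N1 (N2 x) = N3 x" for x
    using cycle[of "N1 (N2 x)"] by (simp add: sq N2.scale ee)
  have f1: "\<omega>1 = fundamental_form h I1"
    by (rule ext)+ (simp add: fundamental_form_def h_def I1_def N1.scale N1.neg sq ee bl)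
  have f2: "\<omega>2 = fundamental_form h N2"
    by (rule ext)+ (simp add: fundamental_form_def h_def N1N2 bl N(3)[of "N3 _"] sq
        bilinear_formD[OF symplecticD(1)[OF s(2)]]
        bilinear_formD[OF symplecticD(1)[OF s(2)]] sq)
  have f3: "\<omega>3 = fundamental_form h (I1 \<circ> N2)"
    by (rule ext)+ (simp add: fundamental_form_def h_def I1_def N1.scale N1.neg sq ee bl N(2))
  have "signed_hyper_kaehler scale bracket e h I1 N2 (I1 \<circ> N2)"
    using S hyper_symplectic_imp_signed_hyper_kaehler[OF e h linI1 lin2 refl]
    by (simp flip: f1 f2 f3)
  then show ?thesis
    using that f1 f2 f3 by blast
qed

lemma signed_hyper_kaehler_iff_hyper_symplectic:
  assumes e: "e \<in> {1, -1}" and "bilinear_form scale h" "Vector_Spaces.linear scale scale I1"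
    "Vector_Spaces.linear scale scale I2"
  shows "signed_hyper_kaehler scale bracket e h I1 I2 I3 \<longleftrightarrow>
    I3 = I1 \<circ> I2 \<and> hyper_symplectic_structure scale bracket e e (-1)
      (fundamental_form h I1) (fundamental_form h I2) (fundamental_form h I3)"
  using hyper_symplectic_imp_signed_hyper_kaehler[OF assms, of I3]
    signed_hyper_kaehler_imp_hyper_symplectic[OF e, of h I1 I2 I3]
  by (auto simp: signed_hyper_kaehler_def)

lemma fundamental_forms_iff_hyper_symplectic:
  assumes e: "e \<in> {1, -1}"
  shows "(\<exists>h I1 I2 I3. signed_hyper_kaehler scale bracket e h I1 I2 I3 \<and>
      \<omega>1 = fundamental_form h I1 \<and> \<omega>2 = fundamental_form h I2 \<and> \<omega>3 = fundamental_form h I3) \<longleftrightarrow>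
    hyper_symplectic_structure scale bracket e e (-1) \<omega>1 \<omega>2 \<omega>3"
  using signed_hyper_kaehler_imp_hyper_symplectic[OF e]
    hyper_symplectic_imp_fundamental_forms[OF e] by metis

end

theorem proposition5p4:
  fixes scale :: "'k::field \<Rightarrow> 'g::ab_group_add \<Rightarrow> 'g"
    and bracket :: "'g \<Rightarrow> 'g \<Rightarrow> 'g"
    and Basis :: "'g set"
  assumes lie: "lie_algebra scale bracket"
    and fin_dim: "finite_dimensional_vector_space scale Basis"
  shows
    "((\<forall>h I1 I2 I3.
        bilinear_form scale h \<and> Vector_Spaces.linear scale scale I1 \<and>
        Vector_Spaces.linear scale scale I2 \<and> Vector_Spaces.linear scale scale I3 \<longrightarrow>
        (hyper_kaehler_structure scale bracket h I1 I2 I3 \<longleftrightarrow>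
          I3 = I1 \<circ> I2 \<and>
          hyper_symplectic_structure scale bracket (-1) (-1) (-1)
            (fundamental_form h I1) (fundamental_form h I2) (fundamental_form h I3))) \<and>
      (\<forall>\<omega>1 \<omega>2 \<omega>3.
        (\<exists>h I1 I2 I3. hyper_kaehler_structure scale bracket h I1 I2 I3 \<and>
          \<omega>1 = fundamental_form h I1 \<and> \<omega>2 = fundamental_form h I2 \<and> \<omega>3 = fundamental_form h I3) \<longleftrightarrow>
        hyper_symplectic_structure scale bracket (-1) (-1) (-1) \<omega>1 \<omega>2 \<omega>3)) \<and>
     ((\<forall>h I1 I2 I3.
        bilinear_form scale h \<and> Vector_Spaces.linear scale scale I1 \<and>
        Vector_Spaces.linear scale scale I2 \<and> Vector_Spaces.linear scale scale I3 \<longrightarrow>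
        (para_hyper_kaehler_structure scale bracket h I1 I2 I3 \<longleftrightarrow>
          I3 = I1 \<circ> I2 \<and>
          hyper_symplectic_structure scale bracket 1 1 (-1)
            (fundamental_form h I1) (fundamental_form h I2) (fundamental_form h I3))) \<and>
      (\<forall>\<omega>1 \<omega>2 \<omega>3.
        (\<exists>h I1 I2 I3. para_hyper_kaehler_structure scale bracket h I1 I2 I3 \<and>
          \<omega>1 = fundamental_form h I1 \<and> \<omega>2 = fundamental_form h I2 \<and> \<omega>3 = fundamental_form h I3) \<longleftrightarrow>
        hyper_symplectic_structure scale bracket 1 1 (-1) \<omega>1 \<omega>2 \<omega>3))"
proof -
  interpret lie_algebra scale bracket by (rule lie)
  interpret finite_dimensional_vector_space scale Basis by (rule fin_dim)
  interpret finite_dimensional_lie_algebra scale bracket Basis ..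
  show ?thesis
    using signed_hyper_kaehler_iff_hyper_symplectic[of "-1"]
      fundamental_forms_iff_hyper_symplectic[of "-1"]
      signed_hyper_kaehler_iff_hyper_symplectic[of 1]
      fundamental_forms_iff_hyper_symplectic[of 1]
    by (simp add: hyper_kaehler_iff_signed para_hyper_kaehler_iff_signed)
qed

end
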